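(* Consider a second order polynomial ODE given by $$u''+b(z)u'+c(z)u=0,$$ where $b,c$ are complex polynomials of a variable $z$. Then the equation above admits a general solution of the form $$u_{\ell,k}(z)=k\exp\Big(\int_0^z\frac{\ell D(\xi)-B(\xi)}{A(\xi)-\ell C(\xi)}\,d\xi\Big),\qquad k,\ell\in\mathbb C .$$
   Context: The Riccati model of the equation $u''+b(z)u'+c(z)u=0$ is the first order equation $\frac{dt}{dz}=-(t^2+b(z)t+c(z))$, obtained by setting $t=u'/u$. The symbols $A,B,C,D$ denote entire functions of $z$ with $AD-BC=1$ such that $g(z,t)=\frac{A(z)t+B(z)}{C(z)t+D(z)}$ is a holomorphic first integral $\mathbb C\times\mathbb P^1\to\mathbb P^1$ of the Riccati model (that is, $g$ is constant along the solutions of the Riccati model), where $\mathbb P^1=\mathbb C\cup\{\infty\}$ is the Riemann sphere.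
   Formalization: Values ℓ with A(0)=ℓC(0), where the integral from 0 diverges, are excluded; "general solution" means each solution u with u(0)≠0 and g(0,u'(0)/u(0))≠∞ has unique (ℓ,k): the form misses the other non-zero solutions (e.g. u=z when b=c=0, A=D=1, B=0, C=−z). *)

theory Defs
  imports "HOL-Complex_Analysis.Complex_Analysis"
begin

text \<open>The Riemann sphere as a set; its complex structure is only used through the two
  charts \<open>t\<close> and \<open>1/t\<close>.\<close>

datatype sphere = Fin complex | Infty

fun sphere_moebius :: "complex \<Rightarrow> complex \<Rightarrow> complex \<Rightarrow> complex \<Rightarrow> sphere \<Rightarrow> sphere" where
  "sphere_moebius \<alpha> \<beta> \<gamma> \<delta> (Fin t) =
     (if \<gamma> * t + \<delta> = 0 then Infty else Fin (moebius \<alpha> \<beta> \<gamma> \<delta> t))"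
| "sphere_moebius \<alpha> \<beta> \<gamma> \<delta> Infty = (if \<gamma> = 0 then Infty else Fin (\<alpha> / \<gamma>))"

definition linear_ode_solution :: "complex poly \<Rightarrow> complex poly \<Rightarrow> (complex \<Rightarrow> complex) \<Rightarrow> bool" where
  "linear_ode_solution b c u \<longleftrightarrow> u holomorphic_on UNIV \<and>
     (\<forall>z. deriv (deriv u) z + poly b z * deriv u z + poly c z * u z = 0)"

text \<open>Sphere-valued holomorphic solutions of \<open>t' = -(t\<^sup>2 + b t + c)\<close> on a domain. In the chart
  \<open>\<sigma> = 1/t\<close> at infinity the equation reads \<open>\<sigma>' = 1 + b \<sigma> + c \<sigma>\<^sup>2\<close>; the inversion \<open>\<sigma> \<mapsto> 1/\<sigma>\<close> is
  \<open>sphere_moebius 0 1 1 0\<close>.\<close>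

definition riccati_solution ::
  "complex poly \<Rightarrow> complex poly \<Rightarrow> complex set \<Rightarrow> (complex \<Rightarrow> sphere) \<Rightarrow> bool" where
  "riccati_solution b c S t \<longleftrightarrow> open S \<and> connected S \<and>
     (\<forall>z\<in>S.
        (\<exists>\<tau>. \<forall>\<^sub>F w in nhds z. t w = Fin (\<tau> w) \<and>
           (\<tau> has_field_derivative - ((\<tau> w)^2 + poly b w * \<tau> w + poly c w)) (at w)) \<or>
        (\<exists>\<sigma>. \<forall>\<^sub>F w in nhds z. t w = sphere_moebius 0 1 1 0 (Fin (\<sigma> w)) \<and>
           (\<sigma> has_field_derivative 1 + poly b w * \<sigma> w + poly c w * (\<sigma> w)^2) (at w)))"

text \<open>Holomorphy of \<open>(z, t) \<mapsto> (A z t + B z) / (C z t + D z)\<close> as a map into the sphere is automatic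
  for entire \<open>A, B, C, D\<close> with determinant 1.\<close>

definition riccati_first_integral ::
  "complex poly \<Rightarrow> complex poly \<Rightarrow> (complex \<Rightarrow> complex) \<Rightarrow> (complex \<Rightarrow> complex) \<Rightarrow>
   (complex \<Rightarrow> complex) \<Rightarrow> (complex \<Rightarrow> complex) \<Rightarrow> bool" where
  "riccati_first_integral b c A B C D \<longleftrightarrow>
     A holomorphic_on UNIV \<and> B holomorphic_on UNIV \<and>
     C holomorphic_on UNIV \<and> D holomorphic_on UNIV \<and>
     (\<forall>z. A z * D z - B z * C z = 1) \<and>
     (\<forall>S t. riccati_solution b c S t \<longrightarrow>
        (\<lambda>z. sphere_moebius (A z) (B z) (C z) (D z) (t z)) constant_on S)"

text \<open>\<open>u = k exp (\<integral>\<^sub>0\<^sup>z (l D - B) / (A - l C))\<close>. The integrand is meromorphic, so the integral is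
  taken along any path from 0 to \<open>z\<close> that avoids the poles. Different paths may give different
  integrals; the requirement is that the exponential is the same for all of them. The base
  point 0 must not be a pole, since otherwise the integral has no meaning. No condition is
  imposed at the poles, where an entire \<open>u\<close> is determined by continuity.\<close>

definition pole_free_path ::
  "(complex \<Rightarrow> complex) \<Rightarrow> (complex \<Rightarrow> complex) \<Rightarrow> complex \<Rightarrow> complex \<Rightarrow> (real \<Rightarrow> complex) \<Rightarrow> bool" where
  "pole_free_path A C l z \<gamma> \<longleftrightarrow>
     valid_path \<gamma> \<and> pathstart \<gamma> = 0 \<and> pathfinish \<gamma> = z \<and>
     path_image \<gamma> \<subseteq> {\<xi>. A \<xi> - l * C \<xi> \<noteq> 0}"

definition has_exp_integral_form ::
  "(complex \<Rightarrow> complex) \<Rightarrow> (complex \<Rightarrow> complex) \<Rightarrow> (complex \<Rightarrow> complex) \<Rightarrow> (complex \<Rightarrow> complex) \<Rightarrow>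
   complex \<Rightarrow> complex \<Rightarrow> (complex \<Rightarrow> complex) \<Rightarrow> bool" where
  "has_exp_integral_form A B C D l k u \<longleftrightarrow> A 0 - l * C 0 \<noteq> 0 \<and>
     (\<forall>z. A z - l * C z \<noteq> 0 \<longrightarrow>
        (\<exists>\<gamma>. pole_free_path A C l z \<gamma>) \<and>
        (\<forall>\<gamma>. pole_free_path A C l z \<gamma> \<longrightarrow>
           u z = k * exp (contour_integral \<gamma> (\<lambda>\<xi>. (l * D \<xi> - B \<xi>) / (A \<xi> - l * C \<xi>)))))"

end

theory Submission imports Defs begin

text \<open>If \<open>u, v\<close> is a fundamental system with Wronskian \<open>W\<close>, a solution \<open>\<alpha> u + \<beta> v\<close> with logarithmic
  derivative \<open>t\<close> has \<open>\<beta> / \<alpha> = (u t - u') / (v' - v t)\<close>. This Moebius map of \<open>t\<close> has determinant \<open>W\<close>,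
  which by Abel's identity has an entire square root, so it can be normalised to a first integral.

  Conversely, let \<open>u\<close> be a solution with \<open>u 0 \<noteq> 0\<close>. For any first integral, \<open>u' / u\<close> stays near 0 on a
  level curve \<open>t = (l D - B) / (A - l C)\<close>. The identity \<open>u' (A - l C) = u (l D - B)\<close> extends to the plane
  by analytic continuation, and it shows that \<open>u\<close> has no zeros where \<open>A - l C \<noteq> 0\<close>: at such a zero
  \<open>u'\<close> would vanish as well. Hence \<open>u\<close> is \<open>u 0\<close> times the exponential of the integral of \<open>u' / u\<close> along
  every path that avoids the poles.\<close>

section \<open>Entire solutions of the linear equation\<close>

text \<open>Taylor coefficients at 0 of the solution with \<open>u 0 = x\<close> and
  \<open>deriv u 0 = y\<close>. The recursion is the coefficient of \<open>z ^ n\<close> in the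
  equation, solved for the coefficient of index \<open>n + 2\<close>.\<close>

fun ode_coeff :: "complex poly \<Rightarrow> complex poly \<Rightarrow> complex \<Rightarrow> complex \<Rightarrow> nat \<Rightarrow> complex" where
  "ode_coeff b c x y 0 = x"
| "ode_coeff b c x y (Suc 0) = y"
| "ode_coeff b c x y (Suc (Suc n)) =
     - (\<Sum>k\<le>n. coeff b k * (of_nat (Suc n - k) * ode_coeff b c x y (Suc n - k))
             + coeff c k * ode_coeff b c x y (n - k)) / (of_nat (Suc n) * of_nat (Suc (Suc n)))"

text \<open>Strong induction: from \<open>N\<close> on, a term inherits every nonnegative bound on
  its predecessors, so the maximum of 0 and the first \<open>N\<close> terms bounds the whole
  sequence.\<close>

lemma bounded_if_eventually_bounded_by_predecessors:
  fixes \<alpha> :: "nat \<Rightarrow> real"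
  assumes "\<And>n K. N \<le> n \<Longrightarrow> 0 \<le> K \<Longrightarrow> \<forall>j<n. \<alpha> j \<le> K \<Longrightarrow> \<alpha> n \<le> K"
  obtains K where "0 \<le> K" "\<And>n. \<alpha> n \<le> K"
proof
  define K where "K = Max (insert 0 (\<alpha> ` {..<N}))"
  show K0: "0 \<le> K" by (simp add: K_def)
  show "\<alpha> n \<le> K" for n
  proof (induction n rule: less_induct)
    case (less n)
    show ?case
    proof (cases "N \<le> n")
      case True
      then show ?thesis using assms K0 less by blast
    next
      case False
      then show ?thesis by (auto simp: K_def intro!: Max_ge)
    qed
  qed
qed

text \<open>Scaled by \<open>R ^ n\<close>, the coefficients satisfy \<open>|a (n+2)| (n+2) \<le> M max |a j|\<close> over \<open>j < n + 2\<close>, so they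
  stop growing once \<open>n + 2 \<ge> M\<close>. As \<open>R\<close> is arbitrary, the power series is entire.\<close>

lemma ode_coeff_step_bound:
  fixes R K M :: real
  assumes "0 < R" "0 \<le> K" "real (Suc (Suc n)) \<ge> M"
    and M: "(\<Sum>k\<le>n. norm (coeff b k) * R ^ (k + 1) + norm (coeff c k) * R ^ (k + 2)) \<le> M"
    and K: "\<forall>j<Suc (Suc n). norm (ode_coeff b c x y j) * R ^ j \<le> K"
  shows "norm (ode_coeff b c x y (Suc (Suc n))) * R ^ Suc (Suc n) \<le> K"
proof -
  let ?a = "ode_coeff b c x y"
  let ?S = "\<Sum>k\<le>n. coeff b k * (of_nat (Suc n - k) * ?a (Suc n - k)) + coeff c k * ?a (n - k)"
  have summand: "norm (coeff b k * (of_nat (Suc n - k) * ?a (Suc n - k)) + coeff c k * ?a (n - k))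
      * R ^ Suc (Suc n)
      \<le> (norm (coeff b k) * R ^ (k + 1) + norm (coeff c k) * R ^ (k + 2)) * (real (Suc n) * K)"
    if "k \<le> n" for k
  proof -
    \<comment> \<open>The power of \<open>R\<close> is split so that each coefficient of the series
      receives the power of its own index; the remaining factor goes to the coefficient of
      \<open>b\<close> or \<open>c\<close>.\<close>
    have e1: "R ^ Suc (Suc n) = R ^ (k + 1) * R ^ (Suc n - k)"
      using that by (simp flip: power_add)
    have e2: "R ^ Suc (Suc n) = R ^ (k + 2) * R ^ (n - k)"
      using that by (simp flip: power_add power_Suc)
    have "norm (coeff b k * (of_nat (Suc n - k) * ?a (Suc n - k))) * R ^ Suc (Suc n)
        = norm (coeff b k) * R ^ (k + 1) * (real (Suc n - k) * (norm (?a (Suc n - k)) * R ^ (Suc n - k)))"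
      unfolding e1 by (simp add: norm_mult del: of_nat_Suc)
    also have "\<dots> \<le> norm (coeff b k) * R ^ (k + 1) * (real (Suc n) * K)"
      using assms by (intro mult_left_mono mult_mono) auto
    finally have b: "norm (coeff b k * (of_nat (Suc n - k) * ?a (Suc n - k))) * R ^ Suc (Suc n)
        \<le> norm (coeff b k) * R ^ (k + 1) * (real (Suc n) * K)" .
    have "norm (coeff c k * ?a (n - k)) * R ^ Suc (Suc n)
        = norm (coeff c k) * R ^ (k + 2) * (1 * (norm (?a (n - k)) * R ^ (n - k)))"
      unfolding e2 by (simp add: norm_mult)
    also have "\<dots> \<le> norm (coeff c k) * R ^ (k + 2) * (real (Suc n) * K)"
      using assms by (intro mult_left_mono mult_mono) auto
    finally have c: "norm (coeff c k * ?a (n - k)) * R ^ Suc (Suc n)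
        \<le> norm (coeff c k) * R ^ (k + 2) * (real (Suc n) * K)" .
    have "norm (coeff b k * (of_nat (Suc n - k) * ?a (Suc n - k)) + coeff c k * ?a (n - k))
        * R ^ Suc (Suc n) \<le> (norm (coeff b k * (of_nat (Suc n - k) * ?a (Suc n - k)))
          + norm (coeff c k * ?a (n - k))) * R ^ Suc (Suc n)"
      using assms(1) by (intro mult_right_mono norm_triangle_ineq) auto
    with b c show ?thesis
      by (simp only: distrib_right)
  qed
  have "norm (?a (Suc (Suc n))) * R ^ Suc (Suc n) * (real (Suc n) * real (Suc (Suc n)))
      = norm ?S * R ^ Suc (Suc n)"
    by (simp add: norm_divide norm_mult del: of_nat_Suc power_Suc)
  also have "\<dots> \<le> (\<Sum>k\<le>n. norm (coeff b k * (of_nat (Suc n - k) * ?a (Suc n - k))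
      + coeff c k * ?a (n - k))) * R ^ Suc (Suc n)"
    using assms(1) by (intro mult_right_mono sum_norm_le) auto
  also have "\<dots> \<le> (\<Sum>k\<le>n. (norm (coeff b k) * R ^ (k + 1) + norm (coeff c k) * R ^ (k + 2))
      * (real (Suc n) * K))"
    unfolding sum_distrib_right by (rule sum_mono) (use summand in simp)
  also have "\<dots> \<le> M * (real (Suc n) * K)"
    unfolding sum_distrib_right[symmetric] using M assms(2) by (intro mult_right_mono) auto
  also have "\<dots> \<le> real (Suc (Suc n)) * (real (Suc n) * K)"
    using assms by (intro mult_right_mono) auto
  also have "\<dots> = K * (real (Suc n) * real (Suc (Suc n)))"
    by simp
  finally show ?thesis
    by (rule mult_right_le_imp_le) simp
qed

text \<open>As \<open>b\<close> and \<open>c\<close> have finitely many nonzero coefficients, one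
  constant \<open>M\<close> bounds their weighted sums for all \<open>n\<close>, and the step bound
  applies from some index on.\<close>

lemma ode_coeff_geometric_bound:
  assumes "0 < (R :: real)"
  obtains K where "0 \<le> K" "\<And>n. norm (ode_coeff b c x y n) * R ^ n \<le> K"
proof -
  define m where "m k = norm (coeff b k) * R ^ (k + 1) + norm (coeff c k) * R ^ (k + 2)" for k
  define d where "d = max (degree b) (degree c)"
  define M where "M = (\<Sum>k\<le>d. m k)"
  have m0: "0 \<le> m k" for k using assms by (simp add: m_def)
  have md: "m k = 0" if "k > d" for k using that by (simp add: m_def d_def coeff_eq_0)
  have M: "(\<Sum>k\<le>n. m k) \<le> M" for n
  proof -
    have "(\<Sum>k\<le>n. m k) \<le> (\<Sum>k\<le>max n d. m k)"
      by (rule sum_mono2) (auto simp: m0)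
    also have "\<dots> = M"
      unfolding M_def by (rule sum.mono_neutral_right) (auto simp: md)
    finally show ?thesis .
  qed
  \<comment> \<open>The summand 2 lets \<open>n\<close> be written as \<open>n' + 2\<close>; the
    ceiling ensures \<open>M \<le> real n\<close>.\<close>
  define N where "N = 2 + nat \<lceil>M\<rceil>"
  show ?thesis
  proof (rule bounded_if_eventually_bounded_by_predecessors
      [of N "\<lambda>n. norm (ode_coeff b c x y n) * R ^ n"])
    fix n K assume n: "N \<le> n" and K: "0 \<le> K" "\<forall>j<n. norm (ode_coeff b c x y j) * R ^ j \<le> K"
    then obtain n' where n': "n = Suc (Suc n')"
      by (metis N_def add_2_eq_Suc le_Suc_ex add_Suc)
    have "M \<le> real n" using n unfolding N_def by linarith
    then show "norm (ode_coeff b c x y n) * R ^ n \<le> K"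
      unfolding n' using K assms M[of n']
      by (intro ode_coeff_step_bound[where M = M]) (auto simp: m_def n')
  qed (use that in blast)
qed

lemma conv_radius_ode_coeff: "conv_radius (ode_coeff b c x y) = \<infinity>"
proof (rule conv_radius_inftyI'')
  fix z :: complex
  \<comment> \<open>Then \<open>norm z \<le> R / 2\<close>, so the terms are dominated by
    \<open>K * (1 / 2) ^ n\<close>; adding 1 keeps \<open>R\<close> positive at
    \<open>z = 0\<close>.\<close>
  define R where "R = 2 * norm z + 1"
  have R: "R > 0" by (simp add: R_def add_nonneg_pos)
  obtain K where K: "0 \<le> K" "\<And>n. norm (ode_coeff b c x y n) * R ^ n \<le> K"
    using ode_coeff_geometric_bound[OF R] by blast
  show "summable (\<lambda>n. ode_coeff b c x y n * z ^ n)"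
  proof (rule summable_comparison_test')
    show "summable (\<lambda>n. K * (1 / 2) ^ n :: real)"
      by (intro summable_mult summable_geometric) auto
    fix n :: nat
    have "norm z ^ n \<le> (R * (1 / 2)) ^ n"
      by (intro power_mono) (auto simp: R_def)
    then have "norm (ode_coeff b c x y n * z ^ n) \<le> norm (ode_coeff b c x y n) * (R * (1 / 2)) ^ n"
      by (simp add: norm_mult norm_power mult_left_mono)
    also have "\<dots> = norm (ode_coeff b c x y n) * R ^ n * (1 / 2) ^ n"
      by (simp add: power_mult_distrib power_divide)
    also have "\<dots> \<le> K * (1 / 2) ^ n"
      using K(2) by (intro mult_right_mono) auto
    finally show "norm (ode_coeff b c x y n * z ^ n) \<le> K * (1 / 2) ^ n" .
  qed
qed

text \<open>The equation is checked coefficientwise for formal power series. Evaluation carries it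
  over to functions, since all series involved converge everywhere.\<close>

lemma linear_ode_solution_exists:
  "\<exists>u. linear_ode_solution b c u \<and> u 0 = x \<and> deriv u 0 = y"
proof -
  define F where "F = Abs_fps (ode_coeff b c x y)"
  have F: "fps_conv_radius F = \<infinity>"
    unfolding fps_conv_radius_def F_def by (simp add: conv_radius_ode_coeff)
  have F': "fps_conv_radius (fps_deriv F) = \<infinity>"
    using fps_conv_radius_deriv[of F] F by simp
  have F'': "fps_conv_radius (fps_deriv (fps_deriv F)) = \<infinity>"
    using fps_conv_radius_deriv[of "fps_deriv F"] F' by simp
  have bF: "fps_conv_radius (fps_of_poly b * fps_deriv F) = \<infinity>"
    using fps_conv_radius_mult[of "fps_of_poly b" "fps_deriv F"] F' by simp
  have cF: "fps_conv_radius (fps_of_poly c * F) = \<infinity>"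
    using fps_conv_radius_mult[of "fps_of_poly c" F] F by simp
  have bcF: "fps_conv_radius (fps_of_poly b * fps_deriv F + fps_of_poly c * F) = \<infinity>"
    using fps_conv_radius_add[of "fps_of_poly b * fps_deriv F" "fps_of_poly c * F"] bF cF by simp
  have ode: "fps_deriv (fps_deriv F) + (fps_of_poly b * fps_deriv F + fps_of_poly c * F) = 0"
  proof (rule fps_ext)
    fix n
    have "fps_nth (fps_of_poly b * fps_deriv F + fps_of_poly c * F) n =
      (\<Sum>k\<le>n. coeff b k * (of_nat (Suc n - k) * ode_coeff b c x y (Suc n - k))
             + coeff c k * ode_coeff b c x y (n - k))"
      by (simp add: fps_mult_nth F_def sum.distrib atLeast0AtMost Suc_diff_le del: of_nat_Suc)
    moreover have "fps_nth (fps_deriv (fps_deriv F)) n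
        = of_nat (Suc n) * of_nat (Suc (Suc n)) * ode_coeff b c x y (Suc (Suc n))"
      by (simp add: F_def)
    ultimately show "fps_nth (fps_deriv (fps_deriv F)
        + (fps_of_poly b * fps_deriv F + fps_of_poly c * F)) n = fps_nth 0 n"
      by (simp del: of_nat_Suc)
  qed
  have d: "deriv (eval_fps F) = eval_fps (fps_deriv F)"
    by (rule ext) (simp add: eval_fps_deriv F)
  have dd: "deriv (eval_fps (fps_deriv F)) = eval_fps (fps_deriv (fps_deriv F))"
    by (rule ext) (simp add: eval_fps_deriv F')
  have "deriv (deriv (eval_fps F)) z + poly b z * deriv (eval_fps F) z + poly c z * eval_fps F z
      = eval_fps (fps_deriv (fps_deriv F) + (fps_of_poly b * fps_deriv F + fps_of_poly c * F)) z" for z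
    unfolding d dd by (simp add: eval_fps_add eval_fps_mult F F' F'' bF cF bcF)
  then have "linear_ode_solution b c (eval_fps F)"
    unfolding linear_ode_solution_def ode by (auto simp: F intro!: holomorphic_on_eval_fps)
  moreover have "eval_fps F 0 = x" "deriv (eval_fps F) 0 = y"
    unfolding d by (simp_all add: eval_fps_at_0 F_def)
  ultimately show ?thesis by blast
qed

section \<open>Wronskians, fundamental systems and uniqueness for the linear equation\<close>

lemma linear_ode_solution_derivs:
  assumes "linear_ode_solution b c u"
  shows "(u has_field_derivative deriv u z) (at z)"
    and "(deriv u has_field_derivative - (poly b z * deriv u z + poly c z * u z)) (at z)"
proof -
  have hol: "u holomorphic_on UNIV"
    and ode: "deriv (deriv u) z + poly b z * deriv u z + poly c z * u z = 0"
    using assms by (auto simp: linear_ode_solution_def)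
  show "(u has_field_derivative deriv u z) (at z)"
    using hol by (intro holomorphic_derivI[of _ UNIV]) auto
  have "(deriv u has_field_derivative deriv (deriv u) z) (at z)"
    using hol by (intro holomorphic_derivI[of _ UNIV] holomorphic_deriv) auto
  moreover have "deriv (deriv u) z = - (poly b z * deriv u z + poly c z * u z)"
    using ode by (simp only: eq_neg_iff_add_eq_0 add.assoc)
  ultimately show "(deriv u has_field_derivative - (poly b z * deriv u z + poly c z * u z)) (at z)"
    by simp
qed

lemma linear_ode_solution_cmult:
  assumes u: "linear_ode_solution b c u"
  shows "linear_ode_solution b c (\<lambda>z. k * u z)"
proof -
  note d = linear_ode_solution_derivs[OF u]
  have d1: "deriv (\<lambda>z. k * u z) = (\<lambda>z. k * deriv u z)"
    by (intro ext DERIV_imp_deriv DERIV_cmult d(1))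
  have d2: "deriv (\<lambda>z. k * deriv u z) z = k * - (poly b z * deriv u z + poly c z * u z)" for z
    by (intro DERIV_imp_deriv DERIV_cmult d(2))
  have "u holomorphic_on UNIV"
    using u by (simp add: linear_ode_solution_def)
  then show ?thesis
    unfolding linear_ode_solution_def d1 d2
    by (auto intro!: holomorphic_intros simp: algebra_simps)
qed

lemma poly_primitive:
  fixes b :: "complex poly"
  obtains E where "\<And>z. (E has_field_derivative poly b z) (at z)"
proof (rule holomorphic_convex_primitive'[of UNIV "poly b"])
  show "poly b holomorphic_on UNIV" by (intro holomorphic_intros)
qed (use that in auto)

text \<open>The Wronskian \<open>W\<close> satisfies \<open>W' = - b W\<close>, so its product with
  \<open>exp E\<close> has derivative 0.\<close>

lemma abel_identity:
  assumes u: "linear_ode_solution b c u" and v: "linear_ode_solution b c v"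
    and E: "\<And>z. (E has_field_derivative poly b z) (at z)"
  shows "u z * deriv v z - deriv u z * v z
    = (u z0 * deriv v z0 - deriv u z0 * v z0) * exp (E z0 - E z)"
proof -
  note [derivative_intros] = linear_ode_solution_derivs[OF u] linear_ode_solution_derivs[OF v]
    DERIV_chain2[OF DERIV_exp E]
  let ?f = "\<lambda>z. (u z * deriv v z - deriv u z * v z) * exp (E z)"
  have "(?f has_field_derivative 0) (at z within UNIV)" for z
    by (rule derivative_eq_intros refl | simp)+ (simp add: algebra_simps)
  then obtain k where "?f z = k" for z
    using has_field_derivative_zero_constant[of UNIV ?f] by auto
  then have "?f z = ?f z0" by metis
  then show ?thesis by (simp add: exp_diff field_simps)
qed

lemma fundamental_system:
  obtains u v where "linear_ode_solution b c u" "linear_ode_solution b c v"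
    "u 0 = 1" "deriv u 0 = 0" "v 0 = 0" "deriv v 0 = 1"
    "\<And>z. u z * deriv v z - deriv u z * v z \<noteq> 0"
proof -
  obtain u where u: "linear_ode_solution b c u" "u 0 = 1" "deriv u 0 = 0"
    using linear_ode_solution_exists by blast
  obtain v where v: "linear_ode_solution b c v" "v 0 = 0" "deriv v 0 = 1"
    using linear_ode_solution_exists by blast
  obtain E where E: "\<And>z. (E has_field_derivative poly b z) (at z)"
    using poly_primitive by blast
  have "u z * deriv v z - deriv u z * v z \<noteq> 0" for z
    using abel_identity[OF u(1) v(1) E, of z 0] u v by simp
  with u v show ?thesis using that by blast
qed

text \<open>The Wronskians of \<open>u\<close> with two independent solutions vanish at
  \<open>z0\<close>, hence everywhere by Abel's identity. At \<open>z\<close> this is a homogeneous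
  linear system for \<open>u z\<close> and \<open>deriv u z\<close> with invertible matrix.\<close>

lemma solution_eq_0_if_zero_data:
  assumes u: "linear_ode_solution b c u" and z0: "u z0 = 0" "deriv u z0 = 0"
  shows "u z = 0"
proof -
  obtain v w where v: "linear_ode_solution b c v" and w: "linear_ode_solution b c w"
    and W: "v z * deriv w z - deriv v z * w z \<noteq> 0"
    using fundamental_system by metis
  obtain E where E: "\<And>z. (E has_field_derivative poly b z) (at z)"
    using poly_primitive by blast
  have "u z * deriv v z = deriv u z * v z" "u z * deriv w z = deriv u z * w z"
    using abel_identity[OF u v E, of z z0] abel_identity[OF u w E, of z z0] z0 by auto
  then have "u z * (v z * deriv w z - deriv v z * w z) = 0"
    by algebra
  with W show ?thesis by simp
qed

section \<open>Existence of a first integral\<close>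

text \<open>The point with homogeneous coordinates \<open>[p : q]\<close>, which treats both charts
  alike. The meaningless pair \<open>p = q = 0\<close> gets the default value
  \<open>Infty\<close>.\<close>

definition sphere_quot :: "complex \<Rightarrow> complex \<Rightarrow> sphere" where
  "sphere_quot p q = (if q = 0 then Infty else Fin (p / q))"

lemma sphere_quot_scale: "r \<noteq> 0 \<Longrightarrow> sphere_quot (r * p) (r * q) = sphere_quot p q"
  by (simp add: sphere_quot_def)

lemma sphere_moebius_Fin:
  "sphere_moebius \<alpha> \<beta> \<gamma> \<delta> (Fin t) = sphere_quot (\<alpha> * t + \<beta>) (\<gamma> * t + \<delta>)"
  by (simp add: sphere_quot_def moebius_def)

text \<open>Numerator and denominator at \<open>t = 1 / \<sigma>\<close> are multiplied by
  \<open>\<sigma>\<close>. The resulting formula is also correct at \<open>\<sigma> = 0\<close>,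
  that is, at \<open>t = Infty\<close>.\<close>

lemma sphere_moebius_inverse_Fin:
  "sphere_moebius \<alpha> \<beta> \<gamma> \<delta> (sphere_moebius 0 1 1 0 (Fin \<sigma>))
    = sphere_quot (\<alpha> + \<beta> * \<sigma>) (\<gamma> + \<delta> * \<sigma>)"
proof (cases "\<sigma> = 0")
  case False
  have "sphere_moebius 0 1 1 0 (Fin \<sigma>) = Fin (1 / \<sigma>)"
    using False by (simp add: moebius_def)
  then have "sphere_moebius \<alpha> \<beta> \<gamma> \<delta> (sphere_moebius 0 1 1 0 (Fin \<sigma>))
      = sphere_quot (\<sigma> * (\<alpha> * (1 / \<sigma>) + \<beta>)) (\<sigma> * (\<gamma> * (1 / \<sigma>) + \<delta>))"
    by (simp only: sphere_moebius_Fin sphere_quot_scale[OF False])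
  then show ?thesis using False by (simp add: distrib_left mult_ac)
qed (simp add: sphere_quot_def)

text \<open>With a common multiplier \<open>m\<close>, the two terms of the quotient rule for
  \<open>P / Q\<close> cancel.\<close>

lemma quotient_locally_constant:
  fixes P Q m :: "complex \<Rightarrow> complex"
  assumes ev: "\<forall>\<^sub>F w in nhds z. (P has_field_derivative m w * P w) (at w)
      \<and> (Q has_field_derivative m w * Q w) (at w)"
    and Qz: "Q z \<noteq> 0"
  shows "\<forall>\<^sub>F w in nhds z. Q w \<noteq> 0 \<and> P w / Q w = P z / Q z"
proof -
  have "isCont Q z"
    using eventually_nhds_x_imp_x[OF ev] by (auto intro: DERIV_isCont)
  then have "\<forall>\<^sub>F w in nhds z. Q w \<noteq> 0"
    using Qz by (intro tendsto_imp_eventually_ne) (auto simp: isCont_def tendsto_at_iff_tendsto_nhds)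
  with ev have "\<forall>\<^sub>F w in nhds z. Q w \<noteq> 0 \<and> (P has_field_derivative m w * P w) (at w)
      \<and> (Q has_field_derivative m w * Q w) (at w)"
    by eventually_elim auto
  then obtain e where e: "e > 0" and ball: "\<And>w. w \<in> ball z e \<Longrightarrow> Q w \<noteq> 0 \<and>
      (P has_field_derivative m w * P w) (at w) \<and> (Q has_field_derivative m w * Q w) (at w)"
    unfolding eventually_nhds_metric by (auto simp: dist_commute)
  have "((\<lambda>w. P w / Q w) has_field_derivative 0) (at w within ball z e)" if "w \<in> ball z e" for w
  proof -
    have "((\<lambda>w. P w / Q w) has_field_derivative
        (m w * P w * Q w - P w * (m w * Q w)) / (Q w * Q w)) (at w)"
      using ball[OF that] by (intro DERIV_divide) auto
    then show ?thesis by (simp add: mult_ac has_field_derivative_at_within)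
  qed
  then obtain k where "\<And>w. w \<in> ball z e \<Longrightarrow> P w / Q w = k"
    using has_field_derivative_zero_constant[of "ball z e" "\<lambda>w. P w / Q w"] by auto
  then have const: "\<And>w. w \<in> ball z e \<Longrightarrow> Q w \<noteq> 0 \<and> P w / Q w = P z / Q z"
    using ball e by auto
  have "\<forall>\<^sub>F w in nhds z. w \<in> ball z e"
    using e by (intro eventually_nhds_in_open) auto
  then show ?thesis
    by (rule eventually_mono) (rule const)
qed

text \<open>Where \<open>Q z = 0\<close>, the roles are exchanged: \<open>Q / P\<close> is
  constantly 0 near \<open>z\<close>, so the point stays at \<open>Infty\<close>.\<close>

lemma sphere_quot_locally_constant:
  assumes ev: "\<forall>\<^sub>F w in nhds z. (P has_field_derivative m w * P w) (at w)
      \<and> (Q has_field_derivative m w * Q w) (at w)"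
    and "P z \<noteq> 0 \<or> Q z \<noteq> 0"
  shows "\<forall>\<^sub>F w in nhds z. sphere_quot (P z) (Q z) = sphere_quot (P w) (Q w)"
proof (cases "Q z = 0")
  case False
  show ?thesis
    using quotient_locally_constant[OF ev False]
    by eventually_elim (use False in \<open>simp add: sphere_quot_def\<close>)
next
  case True
  with assms have "P z \<noteq> 0" by simp
  moreover have "\<forall>\<^sub>F w in nhds z. (Q has_field_derivative m w * Q w) (at w)
      \<and> (P has_field_derivative m w * P w) (at w)"
    using ev by eventually_elim auto
  ultimately have "\<forall>\<^sub>F w in nhds z. P w \<noteq> 0 \<and> Q w / P w = Q z / P z"
    by (intro quotient_locally_constant[where m = m])
  then show ?thesis
    by eventually_elim (auto simp: sphere_quot_def True)
qed

text \<open>Along a Riccati solution the two linear forms \<open>u t - u'\<close> and \<open>v' - v t\<close> satisfy the same first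
  order linear equation, so their ratio is constant.\<close>

lemma riccati_solution_moebius_constant:
  assumes u: "linear_ode_solution b c u" and v: "linear_ode_solution b c v"
    and W: "\<And>z. u z * deriv v z - deriv u z * v z \<noteq> 0"
    and t: "riccati_solution b c S t"
  shows "(\<lambda>z. sphere_moebius (u z) (- deriv u z) (- v z) (deriv v z) (t z)) constant_on S"
proof -
  note [derivative_intros] = linear_ode_solution_derivs[OF u] linear_ode_solution_derivs[OF v]
  let ?g = "\<lambda>z. sphere_moebius (u z) (- deriv u z) (- v z) (deriv v z) (t z)"
  have loc: "\<forall>\<^sub>F w in nhds z. ?g z = ?g w" if "z \<in> S" for z
  proof -
    have "(\<exists>\<tau>. \<forall>\<^sub>F w in nhds z. t w = Fin (\<tau> w) \<and>
           (\<tau> has_field_derivative - ((\<tau> w)^2 + poly b w * \<tau> w + poly c w)) (at w)) \<or>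
        (\<exists>\<sigma>. \<forall>\<^sub>F w in nhds z. t w = sphere_moebius 0 1 1 0 (Fin (\<sigma> w)) \<and>
           (\<sigma> has_field_derivative 1 + poly b w * \<sigma> w + poly c w * (\<sigma> w)^2) (at w))"
      using t that unfolding riccati_solution_def by blast
    then consider
      \<tau> where "\<forall>\<^sub>F w in nhds z. t w = Fin (\<tau> w) \<and>
           (\<tau> has_field_derivative - ((\<tau> w)^2 + poly b w * \<tau> w + poly c w)) (at w)"
      | \<sigma> where "\<forall>\<^sub>F w in nhds z. t w = sphere_moebius 0 1 1 0 (Fin (\<sigma> w)) \<and>
           (\<sigma> has_field_derivative 1 + poly b w * \<sigma> w + poly c w * (\<sigma> w)^2) (at w)"
      by blast
    then show ?thesis
    proof cases
      case 1
      let ?P = "\<lambda>w. u w * \<tau> w + - deriv u w" and ?Q = "\<lambda>w. - v w * \<tau> w + deriv v w"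
      \<comment> \<open>Once second derivatives are replaced by means of the linear equation, the
        terms with \<open>c\<close> cancel and \<open>- (\<tau> + b)\<close> factors out.\<close>
      have "\<forall>\<^sub>F w in nhds z. (?P has_field_derivative - (\<tau> w + poly b w) * ?P w) (at w)
          \<and> (?Q has_field_derivative - (\<tau> w + poly b w) * ?Q w) (at w)"
        using 1
      proof eventually_elim
        case (elim w)
        then have [derivative_intros]:
          "(\<tau> has_field_derivative - ((\<tau> w)^2 + poly b w * \<tau> w + poly c w)) (at w)" by simp
        show ?case
          by (auto intro!: derivative_eq_intros simp: algebra_simps power2_eq_square)
      qed
      \<comment> \<open>If both forms vanished, \<open>(deriv u z, deriv v z)\<close> would be a
        multiple of \<open>(u z, v z)\<close> and the Wronskian would be 0.\<close>
      moreover have "?P z \<noteq> 0 \<or> ?Q z \<noteq> 0"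
      proof (rule ccontr)
        assume "\<not> ?thesis"
        then have "deriv u z = u z * \<tau> z" "deriv v z = v z * \<tau> z"
          by (auto simp: add_eq_0_iff)
        then show False using W[of z] by simp
      qed
      ultimately have "\<forall>\<^sub>F w in nhds z. sphere_quot (?P z) (?Q z) = sphere_quot (?P w) (?Q w)"
        by (rule sphere_quot_locally_constant[where m = "\<lambda>w. - (\<tau> w + poly b w)"])
      with 1 show ?thesis
      proof eventually_elim
        case (elim w)
        moreover have "t z = Fin (\<tau> z)"
          using eventually_nhds_x_imp_x[OF 1] by simp
        ultimately show ?case by (simp only: sphere_moebius_Fin)
      qed
    next
      case 2
      \<comment> \<open>These are the two linear forms multiplied by
        \<open>\<sigma> = 1 / t\<close>. This changes the common multiplier to
        \<open>c \<sigma>\<close>, because now the terms with \<open>b\<close> cancel.\<close>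
      let ?P = "\<lambda>w. u w + - deriv u w * \<sigma> w" and ?Q = "\<lambda>w. - v w + deriv v w * \<sigma> w"
      have "\<forall>\<^sub>F w in nhds z. (?P has_field_derivative (poly c w * \<sigma> w) * ?P w) (at w)
          \<and> (?Q has_field_derivative (poly c w * \<sigma> w) * ?Q w) (at w)"
        using 2
      proof eventually_elim
        case (elim w)
        then have [derivative_intros]:
          "(\<sigma> has_field_derivative 1 + poly b w * \<sigma> w + poly c w * (\<sigma> w)^2) (at w)" by simp
        show ?case
          by (auto intro!: derivative_eq_intros simp: algebra_simps power2_eq_square)
      qed
      moreover have "?P z \<noteq> 0 \<or> ?Q z \<noteq> 0"
      proof (rule ccontr)
        assume "\<not> ?thesis"
        then have "u z = deriv u z * \<sigma> z" "v z = deriv v z * \<sigma> z"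
          by (auto simp: add_eq_0_iff)
        then show False using W[of z] by simp
      qed
      ultimately have "\<forall>\<^sub>F w in nhds z. sphere_quot (?P z) (?Q z) = sphere_quot (?P w) (?Q w)"
        by (rule sphere_quot_locally_constant[where m = "\<lambda>w. poly c w * \<sigma> w"])
      with 2 show ?thesis
      proof eventually_elim
        case (elim w)
        moreover have "t z = sphere_moebius 0 1 1 0 (Fin (\<sigma> z))"
          using eventually_nhds_x_imp_x[OF 2] by blast
        ultimately show ?case by (simp only: sphere_moebius_inverse_Fin)
      qed
    qed
  qed
  have "connected S" using t by (simp add: riccati_solution_def)
  then have "?g x = ?g y" if "x \<in> S" "y \<in> S" for x y
    using that by (rule connected_local_const)
      (use filter_leD[OF at_within_le_nhds loc] in blast)
  then show ?thesis unfolding constant_on_def by metis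
qed

section \<open>Normalisation of the determinant\<close>

lemma sphere_moebius_scale:
  assumes "r \<noteq> 0"
  shows "sphere_moebius (r * \<alpha>) (r * \<beta>) (r * \<gamma>) (r * \<delta>) t = sphere_moebius \<alpha> \<beta> \<gamma> \<delta> t"
proof (cases t)
  case (Fin x)
  have "sphere_quot (r * \<alpha> * x + r * \<beta>) (r * \<gamma> * x + r * \<delta>)
      = sphere_quot (r * (\<alpha> * x + \<beta>)) (r * (\<gamma> * x + \<delta>))"
    by (simp add: algebra_simps)
  then show ?thesis using Fin by (simp only: sphere_moebius_Fin sphere_quot_scale[OF assms])
qed (use assms in simp)

lemma riccati_first_integral_exists: "\<exists>A B C D. riccati_first_integral b c A B C D"
proof -
  obtain u v where u: "linear_ode_solution b c u" and v: "linear_ode_solution b c v"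
    and init: "u 0 = 1" "deriv u 0 = 0" "v 0 = 0" "deriv v 0 = 1"
    and W: "\<And>z. u z * deriv v z - deriv u z * v z \<noteq> 0"
    using fundamental_system by blast
  obtain E where E: "\<And>z. (E has_field_derivative poly b z) (at z)"
    using poly_primitive by blast
  \<comment> \<open>By Abel's identity and the Wronskian 1 at 0, \<open>r z * r z\<close> is the
    reciprocal of the Wronskian. Scaling all four entries by \<open>r\<close> thus gives determinant
    1; halving the exponent makes the root entire.\<close>
  define r where "r z = exp ((E z - E 0) / 2)" for z
  have hol: "u holomorphic_on UNIV" "v holomorphic_on UNIV"
    using u v by (auto simp: linear_ode_solution_def)
  have "E holomorphic_on UNIV"
    using E by (auto simp: holomorphic_on_open)
  then have r_hol: "r holomorphic_on UNIV"
    unfolding r_def by (intro holomorphic_intros) auto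
  have r2: "r z * r z = exp (E z - E 0)" for z
    by (simp add: r_def flip: exp_add)
  have "(r z * u z) * (r z * deriv v z) - (r z * - deriv u z) * (r z * - v z) = 1" for z
  proof -
    have "(r z * u z) * (r z * deriv v z) - (r z * - deriv u z) * (r z * - v z)
        = (u z * deriv v z - deriv u z * v z) * (r z * r z)"
      by (simp add: algebra_simps)
    also have "\<dots> = exp (E 0 - E z) * exp (E z - E 0)"
      using abel_identity[OF u v E, of z 0] init r2 by simp
    also have "\<dots> = 1" by (simp flip: exp_add)
    finally show ?thesis .
  qed
  moreover have "(\<lambda>z. sphere_moebius (r z * u z) (r z * - deriv u z) (r z * - v z) (r z * deriv v z) (t z))
      constant_on S" if "riccati_solution b c S t" for S t
    using riccati_solution_moebius_constant[OF u v W that]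
    by (simp only: sphere_moebius_scale r_def exp_not_eq_zero not_False_eq_True)
  ultimately have "riccati_first_integral b c (\<lambda>z. r z * u z) (\<lambda>z. r z * - deriv u z)
      (\<lambda>z. r z * - v z) (\<lambda>z. r z * deriv v z)"
    unfolding riccati_first_integral_def using hol r_hol
    by (intro conjI allI impI holomorphic_on_mult holomorphic_on_minus holomorphic_deriv) auto
  then show ?thesis by blast
qed

section \<open>Solutions in exponential form\<close>

lemma log_derivative_riccati_solution:
  assumes u: "linear_ode_solution b c u" and S: "open S" "connected S" "\<And>z. z \<in> S \<Longrightarrow> u z \<noteq> 0"
  shows "riccati_solution b c S (\<lambda>z. Fin (deriv u z / u z))"
proof -
  have der: "((\<lambda>z. deriv u z / u z) has_field_derivative
      - ((deriv u w / u w)\<^sup>2 + poly b w * (deriv u w / u w) + poly c w)) (at w)" if "w \<in> S" for w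
  proof -
    have "((\<lambda>z. deriv u z / u z) has_field_derivative
      (- (poly b w * deriv u w + poly c w * u w) * u w - deriv u w * deriv u w) / (u w * u w)) (at w)"
      using S(3)[OF that] by (intro DERIV_divide linear_ode_solution_derivs[OF u])
    moreover have "(- (poly b w * deriv u w + poly c w * u w) * u w - deriv u w * deriv u w) / (u w * u w)
        = - ((deriv u w / u w)\<^sup>2 + poly b w * (deriv u w / u w) + poly c w)"
      using S(3)[OF that] by (simp add: divide_simps power2_eq_square) (simp add: algebra_simps)
    ultimately show ?thesis by simp
  qed
  have "\<forall>\<^sub>F w in nhds z. ((\<lambda>z. deriv u z / u z) has_field_derivative
      - ((deriv u w / u w)\<^sup>2 + poly b w * (deriv u w / u w) + poly c w)) (at w)" if "z \<in> S" for z
    using eventually_nhds_in_open[OF S(1) that] by (rule eventually_mono) (rule der)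
  then show ?thesis
    unfolding riccati_solution_def using S(1,2)
    by (intro conjI ballI disjI1 exI[of _ "\<lambda>z. deriv u z / u z"]) auto
qed

text \<open>Substituting \<open>w = f z\<close> turns the integral into that of \<open>1 / w\<close>
  along the image path, which avoids 0. This is \<open>2 * pi * \<i>\<close> times the winding
  number, whose exponential is the ratio of the end points even for a path that is not
  closed.\<close>

lemma exp_contour_integral_log_derivative:
  assumes f: "f holomorphic_on UNIV" and \<gamma>: "valid_path \<gamma>" "path_image \<gamma> \<subseteq> {z. f z \<noteq> 0}"
  shows "f (pathfinish \<gamma>) = exp (contour_integral \<gamma> (\<lambda>z. deriv f z / f z)) * f (pathstart \<gamma>)"
proof -
  have an: "f analytic_on UNIV" using f by (simp add: analytic_on_open)
  then have vp: "valid_path (f \<circ> \<gamma>)"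
    by (intro valid_path_compose_analytic[OF \<gamma>(1)]) auto
  have 0: "0 \<notin> path_image (f \<circ> \<gamma>)"
    using \<gamma>(2) by (auto simp: path_image_compose)
  have "2 * pi * \<i> * winding_number (f \<circ> \<gamma>) 0 = contour_integral (f \<circ> \<gamma>) (\<lambda>w. 1 / w)"
    using winding_number_valid_path[OF vp 0] by simp
  also have "\<dots> = contour_integral \<gamma> (\<lambda>z. deriv f z / f z)"
    using contour_integral_comp_analyticW[OF an \<gamma>(1), of "\<lambda>w. 1 / w"] by simp
  finally show ?thesis
    using winding_number_exp_2pi[OF valid_path_imp_path[OF vp] 0]
    by (simp add: pathfinish_compose pathstart_compose)
qed

text \<open>This is the inverse Moebius map. On the level curve, determinant 1 gives
  \<open>(\<alpha> - l * \<gamma>) * (\<gamma> * t + \<delta>) = 1\<close>, so each denominator is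
  nonzero in the direction that needs it.\<close>

lemma moebius_level_curve:
  fixes \<alpha> \<beta> \<gamma> \<delta> t l :: complex
  assumes "\<alpha> * \<delta> - \<beta> * \<gamma> = 1"
  shows "sphere_moebius \<alpha> \<beta> \<gamma> \<delta> (Fin t) = Fin l \<longleftrightarrow>
    \<alpha> - l * \<gamma> \<noteq> 0 \<and> t = (l * \<delta> - \<beta>) / (\<alpha> - l * \<gamma>)"
proof
  assume "sphere_moebius \<alpha> \<beta> \<gamma> \<delta> (Fin t) = Fin l"
  then have l: "\<alpha> * t + \<beta> = l * (\<gamma> * t + \<delta>)"
    by (auto simp: moebius_def field_simps split: if_splits)
  have "(\<alpha> - l * \<gamma>) * (\<gamma> * t + \<delta>) = 1"
    using assms l by algebra
  then have "\<alpha> - l * \<gamma> \<noteq> 0" by auto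
  moreover have "t * (\<alpha> - l * \<gamma>) = l * \<delta> - \<beta>"
    using l by (simp add: algebra_simps)
  ultimately show "\<alpha> - l * \<gamma> \<noteq> 0 \<and> t = (l * \<delta> - \<beta>) / (\<alpha> - l * \<gamma>)"
    by (simp add: nonzero_eq_divide_eq)
next
  assume "\<alpha> - l * \<gamma> \<noteq> 0 \<and> t = (l * \<delta> - \<beta>) / (\<alpha> - l * \<gamma>)"
  then have nz: "\<alpha> - l * \<gamma> \<noteq> 0" and t: "t * (\<alpha> - l * \<gamma>) = l * \<delta> - \<beta>"
    by auto
  have "(\<gamma> * t + \<delta>) * (\<alpha> - l * \<gamma>) = 1"
    using assms t by algebra
  then have "\<gamma> * t + \<delta> \<noteq> 0" by auto
  moreover have "\<alpha> * t + \<beta> = l * (\<gamma> * t + \<delta>)"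
    using t by (simp add: algebra_simps)
  ultimately show "sphere_moebius \<alpha> \<beta> \<gamma> \<delta> (Fin t) = Fin l"
    by (simp add: moebius_def)
qed

text \<open>With denominators cleared, both sides are entire, so agreement on a ball around 0 where
  \<open>u\<close> has no zeros suffices.\<close>

lemma solution_on_level_curve:
  assumes I: "riccati_first_integral b c A B C D" and u: "linear_ode_solution b c u"
    and u0: "u 0 \<noteq> 0"
    and l: "sphere_moebius (A 0) (B 0) (C 0) (D 0) (Fin (deriv u 0 / u 0)) = Fin l"
  shows "deriv u z * (A z - l * C z) = u z * (l * D z - B z)"
proof -
  have hol: "u holomorphic_on UNIV" "A holomorphic_on UNIV" "B holomorphic_on UNIV"
    "C holomorphic_on UNIV" "D holomorphic_on UNIV"
    and det: "\<And>z. A z * D z - B z * C z = 1"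
    using I u by (auto simp: riccati_first_integral_def linear_ode_solution_def)
  have "continuous_on UNIV u" using hol(1) by (rule holomorphic_on_imp_continuous_on)
  then have "open {z. u z \<noteq> 0}"
    by (intro open_Collect_neq) auto
  then obtain e where e: "e > 0" "ball 0 e \<subseteq> {z. u z \<noteq> 0}"
    using u0 by (metis (mono_tags) mem_Collect_eq open_contains_ball)
  then have "riccati_solution b c (ball 0 e) (\<lambda>z. Fin (deriv u z / u z))"
    by (intro log_derivative_riccati_solution[OF u]) auto
  then have *: "(\<lambda>z. sphere_moebius (A z) (B z) (C z) (D z) (Fin (deriv u z / u z))) constant_on ball 0 e"
    using I unfolding riccati_first_integral_def by blast
  have const: "sphere_moebius (A z) (B z) (C z) (D z) (Fin (deriv u z / u z)) = Fin l"
    if "z \<in> ball 0 e" for z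
  proof -
    have "0 \<in> ball (0 :: complex) e" using e by simp
    then show ?thesis using * l that unfolding constant_on_def by metis
  qed
  have local: "deriv u z * (A z - l * C z) = u z * (l * D z - B z)" if "z \<in> ball 0 e" for z
  proof -
    have "u z \<noteq> 0" using e that by auto
    then show ?thesis
      using const[OF that] unfolding moebius_level_curve[OF det] by (simp add: field_simps)
  qed
  show ?thesis
    by (rule analytic_continuation_open[of "ball 0 e" UNIV
          "\<lambda>z. deriv u z * (A z - l * C z)" "\<lambda>z. u z * (l * D z - B z)"])
      (use e local hol in \<open>auto intro!: holomorphic_intros\<close>)
qed

text \<open>The entire function \<open>A - l * C\<close> is nonzero at 0, so its zeros are
  countable. Removing them from the plane leaves a connected open set, in which polynomial paths
  join any two points.\<close>

lemma pole_free_path_exists: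
  assumes hol: "A holomorphic_on UNIV" "C holomorphic_on UNIV"
    and "A 0 - l * C 0 \<noteq> 0" "A z - l * C z \<noteq> 0"
  shows "\<exists>\<gamma>. pole_free_path A C l z \<gamma>"
proof -
  let ?f = "\<lambda>z. A z - l * C z"
  let ?Z = "{z \<in> UNIV. ?f z = 0}"
  have f: "?f holomorphic_on UNIV" using hol by (intro holomorphic_intros)
  have "countable ?Z"
  proof (cases "?f constant_on UNIV")
    case True
    then obtain y where "?f z = y" for z unfolding constant_on_def by blast
    with assms(3) have "?f z \<noteq> 0" for z by simp
    then have "?Z = {}" by blast
    then show ?thesis by simp
  next
    case False
    with f show ?thesis by (intro holomorphic_countable_zeros) auto
  qed
  then have "connected (UNIV - ?Z)"
    by (intro connected_open_diff_countable) auto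
  moreover have "UNIV - ?Z = {z. ?f z \<noteq> 0}" by auto
  moreover have "open {z. ?f z \<noteq> 0}"
    using holomorphic_on_imp_continuous_on[OF f] by (intro open_Collect_neq) auto
  ultimately obtain \<gamma> where "polynomial_function \<gamma>" "path_image \<gamma> \<subseteq> {z. ?f z \<noteq> 0}"
    "pathstart \<gamma> = 0" "pathfinish \<gamma> = z"
    using connected_open_polynomial_connected[of "{z. ?f z \<noteq> 0}" 0 z] assms(3,4) by auto
  then show ?thesis
    unfolding pole_free_path_def using valid_path_polynomial_function by blast
qed

lemma solution_has_exp_integral_form:
  assumes I: "riccati_first_integral b c A B C D" and u: "linear_ode_solution b c u"
    and u0: "u 0 \<noteq> 0"
    and l: "sphere_moebius (A 0) (B 0) (C 0) (D 0) (Fin (deriv u 0 / u 0)) = Fin l"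
  shows "has_exp_integral_form A B C D l (u 0) u"
proof -
  have hol: "u holomorphic_on UNIV" "A holomorphic_on UNIV" "C holomorphic_on UNIV"
    and det: "\<And>z. A z * D z - B z * C z = 1"
    using I u by (auto simp: riccati_first_integral_def linear_ode_solution_def)
  note level = solution_on_level_curve[OF I u u0 l]
  have nz0: "A 0 - l * C 0 \<noteq> 0"
    using l unfolding moebius_level_curve[OF det] by blast
  have nz: "u z \<noteq> 0" if "A z - l * C z \<noteq> 0" for z
  proof
    assume "u z = 0"
    then have "deriv u z = 0" using level[of z] that by simp
    with \<open>u z = 0\<close> show False using solution_eq_0_if_zero_data[OF u] u0 by blast
  qed
  have integral: "u z = u 0 * exp (contour_integral \<gamma> (\<lambda>\<xi>. (l * D \<xi> - B \<xi>) / (A \<xi> - l * C \<xi>)))"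
    if "pole_free_path A C l z \<gamma>" for z \<gamma>
  proof -
    from that have \<gamma>: "valid_path \<gamma>" "pathstart \<gamma> = 0" "pathfinish \<gamma> = z"
      and im: "path_image \<gamma> \<subseteq> {\<xi>. A \<xi> - l * C \<xi> \<noteq> 0}"
      by (auto simp: pole_free_path_def)
    have "contour_integral \<gamma> (\<lambda>\<xi>. (l * D \<xi> - B \<xi>) / (A \<xi> - l * C \<xi>))
        = contour_integral \<gamma> (\<lambda>\<xi>. deriv u \<xi> / u \<xi>)"
    proof (rule contour_integral_eq)
      fix \<xi> assume "\<xi> \<in> path_image \<gamma>"
      then have "A \<xi> - l * C \<xi> \<noteq> 0" using im by blast
      with nz level[of \<xi>] show "(l * D \<xi> - B \<xi>) / (A \<xi> - l * C \<xi>) = deriv u \<xi> / u \<xi>"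
        by (simp add: frac_eq_eq mult.commute)
    qed
    moreover have "path_image \<gamma> \<subseteq> {\<xi>. u \<xi> \<noteq> 0}" using im nz by auto
    ultimately show ?thesis
      using exp_contour_integral_log_derivative[OF hol(1) \<gamma>(1)] \<gamma> by (simp add: mult.commute)
  qed
  show ?thesis
    unfolding has_exp_integral_form_def
    using nz0 integral pole_free_path_exists[OF hol(2,3) nz0] by blast
qed

text \<open>Segments from 0 to nearby points avoid the poles, so near 0 the formula reads
  \<open>u z = k * exp (H z - H 0)\<close> with a primitive \<open>H\<close> of the integrand.
  Differentiability of \<open>u\<close> at 0 comes from this formula. The lemma yields the
  uniqueness of \<open>(l, k)\<close>.\<close>

lemma exp_integral_form_initial_data:
  assumes hol: "A holomorphic_on UNIV" "B holomorphic_on UNIV"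
      "C holomorphic_on UNIV" "D holomorphic_on UNIV"
    and form: "has_exp_integral_form A B C D l k u"
  shows "u 0 = k" and "deriv u 0 = k * ((l * D 0 - B 0) / (A 0 - l * C 0))"
proof -
  let ?h = "\<lambda>\<xi>. (l * D \<xi> - B \<xi>) / (A \<xi> - l * C \<xi>)"
  let ?U = "{\<xi>. A \<xi> - l * C \<xi> \<noteq> 0}"
  have nz0: "0 \<in> ?U" using form by (simp add: has_exp_integral_form_def)
  have "continuous_on UNIV (\<lambda>\<xi>. A \<xi> - l * C \<xi>)"
    using hol by (intro holomorphic_on_imp_continuous_on holomorphic_intros)
  then have "open ?U" by (intro open_Collect_neq) auto
  then obtain e where e: "e > 0" "ball 0 e \<subseteq> ?U"
    using nz0 by (meson open_contains_ball)
  have "?h holomorphic_on ball 0 e"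
    using e hol by (auto intro!: holomorphic_intros elim: holomorphic_on_subset)
  then obtain H where H: "\<And>z. z \<in> ball 0 e \<Longrightarrow> (H has_field_derivative ?h z) (at z within ball 0 e)"
    using holomorphic_convex_primitive'[of "ball 0 e" ?h] by auto
  have u: "u z = k * exp (H z - H 0)" if z: "z \<in> ball 0 e" for z
  proof -
    have seg: "path_image (linepath 0 z) \<subseteq> ball 0 e"
      using e z by (simp add: closed_segment_subset)
    have "(?h has_contour_integral H z - H 0) (linepath 0 z)"
      using contour_integral_primitive[OF H valid_path_linepath seg] by simp
    then have "contour_integral (linepath 0 z) ?h = H z - H 0"
      by (rule contour_integral_unique)
    moreover have "pole_free_path A C l z (linepath 0 z)"
      unfolding pole_free_path_def using seg e by auto
    moreover have "A z - l * C z \<noteq> 0" using e z by auto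
    then have "\<forall>\<gamma>. pole_free_path A C l z \<gamma> \<longrightarrow> u z = k * exp (contour_integral \<gamma> ?h)"
      using form unfolding has_exp_integral_form_def by blast
    ultimately show ?thesis by metis
  qed
  then show "u 0 = k" using e by simp
  have "0 \<in> ball (0 :: complex) e" using e by simp
  from H[OF this] have "(H has_field_derivative ?h 0) (at 0)"
    unfolding at_within_open[OF \<open>0 \<in> ball 0 e\<close> open_ball] .
  note [derivative_intros] = DERIV_chain2[OF DERIV_exp DERIV_diff[OF this DERIV_const]]
  have "((\<lambda>z. k * exp (H z - H 0)) has_field_derivative k * ?h 0) (at 0)"
    by (auto intro!: derivative_eq_intros)
  then have "(u has_field_derivative k * ?h 0) (at 0)"
    by (rule has_field_derivative_transform_within_open[of _ _ _ "ball 0 e"]) (use e u in auto)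
  then show "deriv u 0 = k * ?h 0" by (rule DERIV_imp_deriv)
qed

text \<open>The parameter \<open>l\<close> is the level of the first integral on which
  \<open>deriv u / u\<close> lies. The formula forces \<open>u 0 = k\<close>, and for
  \<open>k \<noteq> 0\<close> the level at 0 to be the finite number \<open>l\<close>. If
  \<open>u 0 = 0\<close>, only the zero solution has this form, and \<open>l\<close> is then not
  determined.\<close>

theorem theorem4:
  fixes b c :: "complex poly"
  shows "(\<exists>A B C D. riccati_first_integral b c A B C D) \<and>
    (\<forall>A B C D. riccati_first_integral b c A B C D \<longrightarrow>
       (\<forall>l k. A 0 - l * C 0 \<noteq> 0 \<longrightarrow>
          (\<exists>u. linear_ode_solution b c u \<and> has_exp_integral_form A B C D l k u)) \<and>
       (\<forall>u. linear_ode_solution b c u \<and> u 0 \<noteq> 0 \<and>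
            sphere_moebius (A 0) (B 0) (C 0) (D 0) (Fin (deriv u 0 / u 0)) \<noteq> Infty \<longrightarrow>
          (\<exists>!(l, k). has_exp_integral_form A B C D l k u)))"
proof (intro conjI allI impI)
  show "\<exists>A B C D. riccati_first_integral b c A B C D"
    by (rule riccati_first_integral_exists)
next
  fix A B C D l k
  assume I: "riccati_first_integral b c A B C D" and nz: "A 0 - l * C 0 \<noteq> 0"
  have det: "A 0 * D 0 - B 0 * C 0 = 1"
    using I by (simp add: riccati_first_integral_def)
  \<comment> \<open>The logarithmic derivative at 0 is the preimage of \<open>l\<close> under the
    Moebius map. Starting from \<open>v 0 = 1\<close> and scaling afterwards also covers
    \<open>k = 0\<close>.\<close>
  obtain v where v: "linear_ode_solution b c v" "v 0 = 1"
    "deriv v 0 = (l * D 0 - B 0) / (A 0 - l * C 0)"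
    using linear_ode_solution_exists by blast
  then have "sphere_moebius (A 0) (B 0) (C 0) (D 0) (Fin (deriv v 0 / v 0)) = Fin l"
    unfolding moebius_level_curve[OF det] using nz by simp
  then have "has_exp_integral_form A B C D l (v 0) v"
    using v by (intro solution_has_exp_integral_form[OF I]) auto
  then have "has_exp_integral_form A B C D l k (\<lambda>z. k * v z)"
    unfolding has_exp_integral_form_def v(2) by auto
  moreover have "linear_ode_solution b c (\<lambda>z. k * v z)"
    using v(1) by (rule linear_ode_solution_cmult)
  ultimately show "\<exists>u. linear_ode_solution b c u \<and> has_exp_integral_form A B C D l k u"
    by blast
next
  fix A B C D u
  assume I: "riccati_first_integral b c A B C D"
    and "linear_ode_solution b c u \<and> u 0 \<noteq> 0 \<and>
      sphere_moebius (A 0) (B 0) (C 0) (D 0) (Fin (deriv u 0 / u 0)) \<noteq> Infty"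
  then obtain l where u: "linear_ode_solution b c u" "u 0 \<noteq> 0"
    and l: "sphere_moebius (A 0) (B 0) (C 0) (D 0) (Fin (deriv u 0 / u 0)) = Fin l"
    by (metis sphere.exhaust)
  have hol: "A holomorphic_on UNIV" "B holomorphic_on UNIV"
      "C holomorphic_on UNIV" "D holomorphic_on UNIV"
    and det: "A 0 * D 0 - B 0 * C 0 = 1"
    using I by (auto simp: riccati_first_integral_def)
  show "\<exists>!(l, k). has_exp_integral_form A B C D l k u"
  proof (rule ex1I[of _ "(l, u 0)"])
    show "case (l, u 0) of (l, k) \<Rightarrow> has_exp_integral_form A B C D l k u"
      using solution_has_exp_integral_form[OF I u l] by simp
  next
    fix p assume "case p of (l, k) \<Rightarrow> has_exp_integral_form A B C D l k u"
    then obtain l' k' where p: "p = (l', k')" and form: "has_exp_integral_form A B C D l' k' u"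
      by (cases p) auto
    \<comment> \<open>The formula determines \<open>k' = u 0\<close> and, after cancelling this
      nonzero factor, the logarithmic derivative at 0. Its image under the Moebius map is both
      \<open>Fin l'\<close> and \<open>Fin l\<close>.\<close>
    note init = exp_integral_form_initial_data[OF hol form]
    have "A 0 - l' * C 0 \<noteq> 0" using form by (simp add: has_exp_integral_form_def)
    then have "sphere_moebius (A 0) (B 0) (C 0) (D 0) (Fin (deriv u 0 / u 0)) = Fin l'"
      unfolding moebius_level_curve[OF det] using init u(2) by simp
    with l p init show "p = (l, u 0)" by simp
  qed
qed

end
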